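(* Let $m\ge 3$ be odd and $n\ge 1$. Run Algorithm ODD (described in the context) with $n$ disks and $m$ pegs, and record after the initialization and after every single-step move of any disk the tuple $(a_n,\dots,a_1)$, where $a_i\in\{0,\dots,m-1\}$ is the index of the peg on which disk $D_i$ lies. Then the sequence of recorded tuples is exactly the $m$-ary reflected Gray code $G_n$ of length $n$.
   Context: Disks $D_1,\dots,D_n$ have increasing sizes; pegs $P_0,\dots,P_{m-1}$ are arranged in a row, and a single step moves a disk from $P_i$ to an adjacent peg $P_{i\pm1}$, putting it on top of that peg's stack. Algorithm ODD: Initially all disks are on $P_0$. Then repeat: (i) move $D_1$ step by step for $m-1$ steps, from $P_0$ to $P_{m-1}$ if it is on $P_0$, or from $P_{m-1}$ to $P_0$ if it is on $P_{m-1}$; (ii) among the topmost disks of the $m-1$ pegs that do not carry $D_1$, let $D_k$ be the smallest; if there is no such disk, terminate; (iii) move $D_k$ by one step: if $D_k$ is on $P_0$ or $P_{m-1}$, in the only possible direction; otherwise in the same direction as its previous move. The $m$-ary reflected Gray code $G_n$ is a sequence of $n$-tuples $(a_n,\dots,a_1)$, $0\le a_i<m$, defined recursively: $G_0$ consists of the empty tuple; if $G_n=C_1,C_2,\dots,C_{m^n}$, then $G_{n+1}$ is $C_10,C_11,\dots,C_1(m-1),\ C_2(m-1),C_2(m-2),\dots,C_20,\ C_30,\dots,C_3(m-1),\ C_4(m-1),\dots,C_40,\dots$, i.e. for odd $i$ the tuple $C_i$ is followed by the new rightmost digit running $0,1,\dots,m-1$, and for even $i$ by the new rightmost digit running $m-1,\dots,1,0$;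 here $C_ix$ denotes the tuple whose digits $(a_{n+1},\dots,a_2)$ are those of $C_i$ and whose last digit $a_1$ is $x$. *)

theory Defs
  imports Main "HOL-Library.Monad_Syntax"
begin

datatype direction = Left | Right

fun neighbour :: "nat \<Rightarrow> direction \<Rightarrow> nat \<Rightarrow> nat option" where
  "neighbour m Left i = (if 0 < i then Some (i - 1) else None)"
| "neighbour m Right i = (if i + 1 < m then Some (i + 1) else None)"

text \<open>
  Disk \<open>D\<^sub>k\<close> is represented by the number \<open>k \<ge> 1\<close>, so comparing sizes means comparing numbers.
  A stack lists the disks of a peg from top to bottom; only the pegs \<open>i < m\<close> are relevant.
  The last direction of a disk is \<open>None\<close> as long as the disk has not been moved.
\<close>
record config =
  stack :: "nat \<Rightarrow> nat list"
  last_dir :: "nat \<Rightarrow> direction option"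

text \<open>Well-defined as each disk lies on exactly one peg, which every move preserves.\<close>
definition peg_of :: "nat \<Rightarrow> config \<Rightarrow> nat \<Rightarrow> nat" where
  "peg_of m s d = (THE i. i < m \<and> d \<in> set (stack s i))"

text \<open>
  The result is \<open>None\<close> if the step is impossible: there is no adjacent peg in the given
  direction, or the disk is not on top of its stack. Size is not compared with the disk below:
  the algorithm imposes no such condition.
\<close>
definition move :: "nat \<Rightarrow> nat \<Rightarrow> direction \<Rightarrow> config \<Rightarrow> config option" where
  "move m d \<delta> s =
    (let i = peg_of m s d in
     case neighbour m \<delta> i of
       None \<Rightarrow> None
     | Some j \<Rightarrow>
         if stack s i \<noteq> [] \<and> hd (stack s i) = d
         then Some \<lparr>stack = (stack s)(i := tl (stack s i), j := d # stack s j),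
                    last_dir = (last_dir s)(d := Some \<delta>)\<rparr>
         else None)"

text \<open>The configurations reached after each of \<open>k\<close> successive steps of disk \<open>d\<close>.\<close>
fun moves :: "nat \<Rightarrow> nat \<Rightarrow> direction \<Rightarrow> nat \<Rightarrow> config \<Rightarrow> config list option" where
  "moves m d \<delta> 0 s = Some []"
| "moves m d \<delta> (Suc k) s = do {
     s' \<leftarrow> move m d \<delta> s;
     ss \<leftarrow> moves m d \<delta> k s';
     Some (s' # ss)
   }"

definition sweep_dir :: "nat \<Rightarrow> config \<Rightarrow> direction option" where
  "sweep_dir m s =
    (if peg_of m s 1 = 0 then Some Right
     else if peg_of m s 1 = m - 1 then Some Left
     else None)"

definition other_tops :: "nat \<Rightarrow> config \<Rightarrow> nat set" where
  "other_tops m s = {hd (stack s i) | i. i < m \<and> 1 \<notin> set (stack s i) \<and> stack s i \<noteq> []}"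

definition step_dir :: "nat \<Rightarrow> config \<Rightarrow> nat \<Rightarrow> direction option" where
  "step_dir m s k =
    (if peg_of m s k = 0 then Some Right
     else if peg_of m s k = m - 1 then Some Left
     else last_dir s k)"

text \<open>
  The main loop returns the configurations reached after each single step, up to termination.
  The result is \<open>None\<close> if a prescribed step is impossible or undefined; as the loop is
  the least fixed point in the option order, it is also \<open>None\<close> if the loop does not terminate.
\<close>
partial_function (option) odd_loop :: "nat \<Rightarrow> config \<Rightarrow> config list option" where
  "odd_loop m s = do {
     \<delta> \<leftarrow> sweep_dir m s;
     ss \<leftarrow> moves m 1 \<delta> (m - 1) s;
     let s' = last (s # ss);
     if other_tops m s' = {} then Some ss
     else do {
       let k = Min (other_tops m s');
       \<epsilon> \<leftarrow> step_dir m s' k;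
       s'' \<leftarrow> move m k \<epsilon> s';
       rest \<leftarrow> odd_loop m s'';
       Some (ss @ s'' # rest)
     }
   }"

definition initial :: "nat \<Rightarrow> config" where
  "initial n = \<lparr>stack = (\<lambda>i. if i = 0 then [1..<n + 1] else []), last_dir = (\<lambda>_. None)\<rparr>"

definition algorithm_ODD :: "nat \<Rightarrow> nat \<Rightarrow> config list option" where
  "algorithm_ODD m n = do {
     ss \<leftarrow> odd_loop m (initial n);
     Some (initial n # ss)
   }"

text \<open>The tuple \<open>(a\<^sub>n, \<dots>, a\<^sub>1)\<close>, as a list starting with \<open>a\<^sub>n\<close>.\<close>
definition peg_tuple :: "nat \<Rightarrow> nat \<Rightarrow> config \<Rightarrow> nat list" where
  "peg_tuple m n s = map (peg_of m s) (rev [1..<n + 1])"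

definition recorded_tuples :: "nat \<Rightarrow> nat \<Rightarrow> nat list list option" where
  "recorded_tuples m n = map_option (map (peg_tuple m n)) (algorithm_ODD m n)"

text \<open>
  Positions in a list are counted from \<open>0\<close>, so the tuples \<open>C\<^sub>i\<close> with odd \<open>i\<close> are those at even
  positions.
\<close>
fun gray_code :: "nat \<Rightarrow> nat \<Rightarrow> nat list list" where
  "gray_code m 0 = [[]]"
| "gray_code m (Suc n) =
    concat (map (\<lambda>(i, C). map (\<lambda>x. C @ [x]) (if even i then [0..<m] else rev [0..<m]))
                (enumerate 0 (gray_code m n)))"

end

theory Submission imports Defs begin

text \<open>
  Write tuples with the digit \<open>a\<^sub>1\<close> first. In the Gray code the digit \<open>a\<^sub>k\<close> runs upwards or downwards
  according to the parity of the sum of the digits \<open>a\<^sub>j\<close>, \<open>j > k\<close>, and the digit that changes is the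
  smallest one that is not at the end of its run. As \<open>m - 1\<close> is even, a digit at the end of its run
  does not affect parities. Hence, whenever \<open>D\<^sub>1\<close> has completed a sweep, all disks below the one that
  changes next lie on the peg of \<open>D\<^sub>1\<close>, while this disk lies on another peg and does not move to that
  of \<open>D\<^sub>1\<close>. So it is the disk chosen by the algorithm, and no disk is ever put on a smaller one.
  Moreover a disk lies on an extreme peg whenever the parity above it changes, so a disk on an inner
  peg keeps the direction of its previous move.
\<close>

section \<open>Successors in the Gray code\<close>

text \<open>The argument holds the higher digits. The parity of their sum stands in for the position
  parity in \<open>gray_code\<close>, so that a tuple alone determines the direction.\<close>

definition run_dir :: "nat list \<Rightarrow> direction" where
  "run_dir ys = (if even (sum_list ys) then Right else Left)"

definition run_start :: "nat \<Rightarrow> nat list \<Rightarrow> nat" where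
  "run_start m ys = (if even (sum_list ys) then 0 else m - 1)"

definition run_end :: "nat \<Rightarrow> nat list \<Rightarrow> nat" where
  "run_end m ys = (if even (sum_list ys) then m - 1 else 0)"

definition block :: "nat \<Rightarrow> nat list \<Rightarrow> nat list list" where
  "block m ys = map (\<lambda>x. x # ys) (if even (sum_list ys) then [0..<m] else rev [0..<m])"

text \<open>A carry without reset: a digit at the end of its run stays there while the higher digits
  advance, because its next run goes backwards.\<close>

fun gray_succ :: "nat \<Rightarrow> nat list \<Rightarrow> nat list option" where
  "gray_succ m [] = None"
| "gray_succ m (x # ys) =
    (case neighbour m (run_dir ys) x of
       Some y \<Rightarrow> Some (y # ys)
     | None \<Rightarrow> map_option ((#) x) (gray_succ m ys))"

lemma even_run_end: "odd m \<Longrightarrow> even (run_end m ys)"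
  by (simp add: run_end_def)

lemma neighbour_run_dir_None_iff:
  assumes "x < m"
  shows "neighbour m (run_dir ys) x = None \<longleftrightarrow> x = run_end m ys"
  using assms by (auto simp: run_dir_def run_end_def)

lemma even_neighbour: "neighbour m \<delta> x = Some y \<Longrightarrow> even y \<longleftrightarrow> odd x"
  by (cases \<delta>) (auto split: if_splits)

lemma neighbour_less: "neighbour m \<delta> x = Some y \<Longrightarrow> x < m \<Longrightarrow> y < m"
  by (cases \<delta>) (auto split: if_splits)

lemma neighbour_neq: "neighbour m \<delta> x = Some y \<Longrightarrow> y \<noteq> x"
  by (cases \<delta>) (auto split: if_splits)

lemma even_sum_gray_succ:
  "gray_succ m ys = Some zs \<Longrightarrow> even (sum_list zs) \<longleftrightarrow> odd (sum_list ys)"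
  by (induction ys arbitrary: zs) (auto split: option.splits dest: even_neighbour)

text \<open>Every digit is at the end of its own run. These ends are even, so all suffixes have the
  same parity and hence the same run end. With D_1 there too, this is the terminating state.\<close>

lemma gray_succ_None:
  assumes "odd m" and "set ys \<subseteq> {..<m}" and "gray_succ m ys = None"
  shows "\<forall>y\<in>set ys. y = run_end m ys"
  using assms(2,3)
proof (induction ys)
  case (Cons x ys)
  then have "x = run_end m ys" "gray_succ m ys = None"
    by (auto split: option.splits simp: neighbour_run_dir_None_iff)
  moreover from this have "run_end m (x # ys) = run_end m ys"
    using even_run_end[OF assms(1)] by (simp add: run_end_def)
  ultimately show ?case using Cons by auto
qed simp

text \<open>Prepares the choice of the disk: \<open>run_end m ys\<close> will be the peg of D_1,
  shared by the disks of the digits before \<open>k\<close>, and the disk of digit \<open>k\<close>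
  neither leaves nor enters it.\<close>

lemma gray_succ_Some:
  assumes "odd m" and "set ys \<subseteq> {..<m}" and "gray_succ m ys = Some zs"
  shows "\<exists>k j. k < length ys \<and> zs = ys[k := j] \<and> (\<forall>e<k. ys ! e = run_end m ys) \<and>
    neighbour m (run_dir (drop (Suc k) ys)) (ys ! k) = Some j \<and>
    ys ! k \<noteq> run_end m ys \<and> j \<noteq> run_end m ys"
  using assms(2,3)
proof (induction ys arbitrary: zs)
  case (Cons x ys)
  have x: "x < m" using Cons.prems by simp
  show ?case
  proof (cases "neighbour m (run_dir ys) x")
    case None
    then have x_end: "x = run_end m ys" using x by (simp add: neighbour_run_dir_None_iff)
    then have same: "run_end m (x # ys) = run_end m ys"
      using even_run_end[OF assms(1)] by (simp add: run_end_def)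
    obtain ws where ws: "gray_succ m ys = Some ws" "zs = x # ws"
      using Cons.prems None by auto
    obtain k j where k: "k < length ys" "ws = ys[k := j]" "\<forall>e<k. ys ! e = run_end m ys"
      "neighbour m (run_dir (drop (Suc k) ys)) (ys ! k) = Some j"
      "ys ! k \<noteq> run_end m ys" "j \<noteq> run_end m ys"
      using Cons.IH[OF _ ws(1)] Cons.prems by auto
    show ?thesis
      by (rule exI[of _ "Suc k"], rule exI[of _ j])
        (use k ws x_end same in \<open>auto simp: nth_Cons split: nat.splits\<close>)
  next
    case (Some y)
    \<comment> \<open>For even \<open>x\<close> this is the end of the run of \<open>x\<close>,
      which \<open>x\<close> has not reached and which differs from the odd \<open>y\<close>. For
      odd \<open>x\<close> it is the start of that run, which both have left behind.\<close>
    have "x \<noteq> run_end m (x # ys)" "y \<noteq> run_end m (x # ys)"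
      using Some assms(1) x
      by (auto simp: run_dir_def run_end_def split: if_splits) presburger+
    then show ?thesis using Some Cons.prems by (intro exI[of _ 0] exI[of _ y]) auto
  qed
qed simp

lemma set_gray_succ:
  "gray_succ m ys = Some zs \<Longrightarrow> set ys \<subseteq> {..<m} \<Longrightarrow> set zs \<subseteq> {..<m}"
  by (induction ys arbitrary: zs) (auto split: option.splits dest: neighbour_less)

lemma length_gray_succ: "gray_succ m ys = Some zs \<Longrightarrow> length zs = length ys"
  by (induction ys arbitrary: zs) (auto split: option.splits)

section \<open>The Gray code as a chain of successors\<close>

abbreviation gray_chain :: "nat \<Rightarrow> nat list list \<Rightarrow> bool" where
  "gray_chain m \<equiv> successively (\<lambda>ys zs. gray_succ m ys = Some zs)"

lemma hd_block: "m > 0 \<Longrightarrow> hd (block m ys) = run_start m ys # ys"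
  by (simp add: block_def run_start_def hd_map hd_rev)

lemma last_block: "m > 0 \<Longrightarrow> last (block m ys) = run_end m ys # ys"
  by (simp add: block_def run_end_def last_map last_rev)

lemma block_nonempty: "m > 0 \<Longrightarrow> block m ys \<noteq> []"
  by (simp add: block_def)

lemma gray_chain_block: "gray_chain m (block m ys)"
  by (auto simp: block_def run_dir_def successively_conv_nth rev_nth)

text \<open>One digit changes by one, which flips the parity. So D_1 starts its next sweep where the
  last one ended.\<close>

lemma run_start_succ:
  assumes "gray_succ m ys = Some zs"
  shows "run_start m zs = run_end m ys"
  using even_sum_gray_succ[OF assms] by (auto simp: run_start_def run_end_def)

lemma run_end_less: "m > 0 \<Longrightarrow> run_end m ys < m"
  by (simp add: run_end_def)

lemma gray_succ_last_block:
  "m > 0 \<Longrightarrow> gray_succ m (run_end m ys # ys) = map_option ((#) (run_end m ys)) (gray_succ m ys)"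
  using neighbour_run_dir_None_iff[of "run_end m ys" m ys] run_end_less by simp

text \<open>Inside a block the first digit runs on. At a junction it stays, by
  \<open>run_start_succ\<close>, and the carry reaches the higher digits.\<close>

lemma gray_chain_blocks:
  assumes "m > 0"
  shows "gray_chain m yss \<Longrightarrow> gray_chain m (concat (map (block m) yss))"
proof (induction yss rule: induct_list012)
  case (3 ys zs yss)
  then have succ: "gray_succ m ys = Some zs" by simp
  have "gray_chain m (concat (map (block m) (zs # yss)))" using 3 by simp
  moreover have "gray_succ m (last (block m ys)) = Some (hd (concat (map (block m) (zs # yss))))"
    using assms succ
    by (simp add: last_block hd_block block_nonempty gray_succ_last_block run_start_succ hd_append
        del: gray_succ.simps)
  ultimately show ?case
    using gray_chain_block[of m ys] by (simp add: successively_append_iff)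
qed (auto simp: gray_chain_block)

lemma gray_chain_parity:
  assumes "gray_chain m yss" and "i < length yss"
  shows "even (sum_list (yss ! i)) \<longleftrightarrow> (even i \<longleftrightarrow> even (sum_list (hd yss)))"
  using assms(2)
proof (induction i)
  case 0
  then show ?case by (simp add: hd_conv_nth)
next
  case (Suc i)
  then have "gray_succ m (yss ! i) = Some (yss ! Suc i)"
    using assms(1) by (simp add: successively_conv_nth)
  then show ?case using Suc even_sum_gray_succ by auto
qed

text \<open>The digit sum parity alternates along the chain from an even start, so it agrees with
  the position parity. The reversals are due to \<open>gray_code\<close> appending the lowest
  digit.\<close>

lemma gray_code_Suc_blocks:
  assumes "gray_chain m (map rev (gray_code m n))"
    and "hd (map rev (gray_code m n)) = replicate n 0"
  shows "map rev (gray_code m (Suc n)) = concat (map (block m) (map rev (gray_code m n)))"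
proof -
  have par: "even (sum_list (gray_code m n ! i)) \<longleftrightarrow> even i" if "i < length (gray_code m n)" for i
    using gray_chain_parity[OF assms(1), of i] that assms(2)
    by (simp add: sum_list_replicate)
  have "map (\<lambda>(i, C). map (\<lambda>x. C @ [x]) (if even i then [0..<m] else rev [0..<m]))
      (enumerate 0 (gray_code m n)) = map (\<lambda>C. map rev (block m (rev C))) (gray_code m n)"
    by (rule nth_equalityI) (auto simp: nth_enumerate_eq par block_def)
  then show ?thesis by (simp add: map_concat comp_def)
qed

text \<open>Proved together, because \<open>gray_code_Suc_blocks\<close> needs both the chain and
  its zero head for the previous length.\<close>

lemma gray_code_chain:
  assumes "m > 0"
  shows "gray_code m n \<noteq> [] \<and> gray_chain m (map rev (gray_code m n)) \<and>
    hd (map rev (gray_code m n)) = replicate n 0 \<and>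
    gray_succ m (last (map rev (gray_code m n))) = None"
proof (induction n)
  case (Suc n)
  let ?L = "map rev (gray_code m n)"
  have eq: "map rev (gray_code m (Suc n)) = concat (map (block m) ?L)"
    using Suc gray_code_Suc_blocks by blast
  have ne: "?L \<noteq> []" using Suc by simp
  have "concat (map (block m) ?L) \<noteq> []" using ne block_nonempty[OF assms] by (cases ?L) auto
  then have 1: "gray_code m (Suc n) \<noteq> []" using eq by (metis list.map_disc_iff)
  have "hd (concat (map (block m) ?L)) = hd (block m (hd ?L))"
    using ne block_nonempty[OF assms] by (cases ?L) (auto simp: hd_append)
  then have 2: "hd (concat (map (block m) ?L)) = replicate (Suc n) 0"
    using Suc assms by (simp add: hd_block run_start_def sum_list_replicate)
  have "last (concat (map (block m) ?L)) = last (block m (last ?L))"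
    using ne block_nonempty[OF assms] by (cases ?L rule: rev_cases) (auto simp: last_append)
  then have 3: "gray_succ m (last (concat (map (block m) ?L))) = None"
    using Suc assms by (simp add: last_block gray_succ_last_block del: gray_succ.simps)
  show ?case using 1 2 3 gray_chain_blocks[OF assms, of ?L] Suc unfolding eq by blast
qed simp

section \<open>Sorted configurations\<close>

text \<open>Entry \<open>k\<close> is the peg of disk \<open>Suc k\<close>, hence
  \<open>d - 1\<close>. Filtering an increasing list puts the smallest disk on top.\<close>

definition sorted_config :: "nat list \<Rightarrow> (nat \<Rightarrow> direction option) \<Rightarrow> config" where
  "sorted_config xs f =
    \<lparr>stack = (\<lambda>i. filter (\<lambda>d. xs ! (d - 1) = i) [1..<length xs + 1]), last_dir = f\<rparr>"

lemma initial_sorted: "initial n = sorted_config (replicate n 0) (\<lambda>_. None)"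
  unfolding initial_def sorted_config_def
  by (auto intro!: ext filter_True[symmetric] filter_False[symmetric])

lemma peg_of_sorted:
  assumes "set xs \<subseteq> {..<m}" and "k < length xs"
  shows "peg_of m (sorted_config xs f) (Suc k) = xs ! k"
  unfolding peg_of_def using assms
  by (intro the_equality) (auto simp: sorted_config_def subset_eq simp del: upt_Suc)

lemma peg_tuple_sorted:
  assumes "set xs \<subseteq> {..<m}"
  shows "peg_tuple m (length xs) (sorted_config xs f) = rev xs"
proof -
  have "map (peg_of m (sorted_config xs f)) [1..<length xs + 1] = xs"
    by (rule nth_equalityI) (use assms in \<open>auto simp: peg_of_sorted simp del: upt_Suc\<close>)
  then show ?thesis unfolding peg_tuple_def by (simp only: flip: rev_map)
qed

lemma upt_split: "k < n \<Longrightarrow> [1..<n + 1] = [1..<Suc k] @ Suc k # [Suc (Suc k)..<n + 1]"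
  using upt_add_eq_append[of 1 "Suc k" "n - k"] by (simp add: upt_conv_Cons del: upt_Suc)

lemma stack_sorted_split:
  assumes "k < length xs" and "\<forall>e<k. xs ! e \<noteq> i"
  shows "stack (sorted_config xs f) i =
    (if xs ! k = i then [Suc k] else []) @
    filter (\<lambda>d. xs ! (d - 1) = i) [Suc (Suc k)..<length xs + 1]"
proof -
  have "xs ! (d - 1) \<noteq> i" if "d \<in> set [1..<Suc k]" for d
    using assms(2) that by (simp add: less_eq_Suc_le del: upt_Suc)
  then have "filter (\<lambda>d. xs ! (d - 1) = i) [1..<Suc k] = []"
    by (simp add: filter_empty_conv del: upt_Suc)
  then show ?thesis
    unfolding sorted_config_def using upt_split[OF assms(1)] by (simp del: upt_Suc)
qed

text \<open>No smaller disk on the source peg makes the disk topmost; none on the target peg keeps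
  that stack sorted.\<close>

lemma move_sorted:
  assumes "set xs \<subseteq> {..<m}" and k: "k < length xs"
    and j: "neighbour m \<delta> (xs ! k) = Some j"
    and below: "\<forall>e<k. xs ! e \<noteq> xs ! k \<and> xs ! e \<noteq> j"
  shows "move m (Suc k) \<delta> (sorted_config xs f) =
    Some (sorted_config (xs[k := j]) (f(Suc k := Some \<delta>)))"
proof -
  let ?s = "sorted_config xs f" and ?i = "xs ! k"
  let ?t = "sorted_config (xs[k := j]) (f(Suc k := Some \<delta>))"
  let ?F = "\<lambda>xs i. filter (\<lambda>d. xs ! (d - 1) = i) [Suc (Suc k)..<length xs + 1]"
  have ij: "j \<noteq> ?i" using neighbour_neq[OF j] .
  \<comment> \<open>The larger disks have entries other than \<open>k\<close>, so the update does
    not affect them.\<close>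
  have F: "?F (xs[k := j]) p = ?F xs p" for p
    by (auto intro!: filter_cong simp del: upt_Suc)
  have si: "stack ?s ?i = Suc k # ?F xs ?i"
    using stack_sorted_split[OF k, of ?i f] below by simp
  have sj: "stack ?s j = ?F xs j"
    using stack_sorted_split[OF k, of j f] below ij by simp
  have ti: "stack ?t ?i = ?F xs ?i"
    using stack_sorted_split[of k "xs[k := j]" ?i] F[of ?i] k below ij by (simp del: upt_Suc)
  have tj: "stack ?t j = Suc k # ?F xs j"
    using stack_sorted_split[of k "xs[k := j]" j] F[of j] k below ij by (simp del: upt_Suc)
  have other: "stack ?t p = stack ?s p" if "p \<noteq> ?i" "p \<noteq> j" for p
    unfolding sorted_config_def using that k
    by (auto intro!: filter_cong simp: nth_list_update simp del: upt_Suc)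
  have "(stack ?s)(?i := tl (stack ?s ?i), j := Suc k # stack ?s j) = stack ?t"
    using si sj ti tj other ij by (auto simp: fun_eq_iff)
  moreover have "last_dir ?s = f" "last_dir ?t = f(Suc k := Some \<delta>)"
    by (simp_all add: sorted_config_def)
  ultimately show ?thesis
    unfolding move_def Let_def peg_of_sorted[OF assms(1) k] j using si by simp
qed

section \<open>Sweeps of the smallest disk\<close>

lemma moves_Right_sorted:
  assumes "set ys \<subseteq> {..<m}"
  shows "x + k < m \<Longrightarrow> moves m 1 Right k (sorted_config (x # ys) f) =
    Some (map (\<lambda>y. sorted_config (y # ys) (f(1 := Some Right))) [Suc x..<Suc (x + k)])"
proof (induction k arbitrary: x f)
  case (Suc k)
  have "move m 1 Right (sorted_config (x # ys) f) =
      Some (sorted_config (Suc x # ys) (f(1 := Some Right)))"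
    using move_sorted[of "x # ys" m 0 Right "Suc x" f] assms Suc.prems by simp
  then show ?case
    using Suc.IH[of "Suc x"] Suc.prems
    by (simp add: upt_conv_Cons del: upt_Suc fun_upd_apply)
qed simp

lemma moves_Left_sorted:
  assumes "set ys \<subseteq> {..<m}"
  shows "x < m \<Longrightarrow> k \<le> x \<Longrightarrow> moves m 1 Left k (sorted_config (x # ys) f) =
    Some (map (\<lambda>y. sorted_config (y # ys) (f(1 := Some Left))) (rev [x - k..<x]))"
proof (induction k arbitrary: x f)
  case (Suc k)
  obtain x' where x': "x = Suc x'" using Suc.prems by (cases x) auto
  have "move m 1 Left (sorted_config (x # ys) f) =
      Some (sorted_config (x' # ys) (f(1 := Some Left)))"
    using move_sorted[of "x # ys" m 0 Left "x'" f] assms Suc.prems x' by simp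
  then show ?case
    using Suc.IH[of x'] Suc.prems x' by (simp del: fun_upd_apply)
qed simp

text \<open>\<open>tl\<close> drops the configuration before the sweep, which has been recorded
  already.\<close>

lemma sweep_sorted:
  fixes f :: "nat \<Rightarrow> direction option"
  assumes "m \<ge> 2" and ys: "set ys \<subseteq> {..<m}"
  defines "s \<equiv> sorted_config (run_start m ys # ys) f"
    and "g \<equiv> f(1 := Some (run_dir ys))"
  shows "sweep_dir m s = Some (run_dir ys)"
    and "moves m 1 (run_dir ys) (m - 1) s = Some (map (\<lambda>xs. sorted_config xs g) (tl (block m ys)))"
proof -
  have "run_start m ys < m" using assms(1) by (simp add: run_start_def)
  then have "peg_of m s 1 = run_start m ys"
    using peg_of_sorted[of "run_start m ys # ys" m 0 f] ys by (simp add: s_def)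
  \<comment> \<open>\<open>m \<ge> 2\<close> keeps the pegs 0 and \<open>m - 1\<close> apart, as
    \<open>sweep_dir\<close> tests peg 0 first.\<close>
  then show "sweep_dir m s = Some (run_dir ys)"
    using assms(1) by (simp add: sweep_dir_def run_dir_def run_start_def)
  obtain m' where m': "m = Suc m'" using assms(1) by (cases m) auto
  show "moves m 1 (run_dir ys) (m - 1) s = Some (map (\<lambda>xs. sorted_config xs g) (tl (block m ys)))"
  proof (cases "even (sum_list ys)")
    case True
    have "tl [0..<m] = [1..<m]" by (simp add: tl_upt)
    then show ?thesis
      using True moves_Right_sorted[OF ys, of 0 m'] m'
      by (simp add: s_def g_def run_dir_def run_start_def block_def map_tl[symmetric] comp_def del: upt_Suc)
  next
    case False
    then show ?thesis
      using moves_Left_sorted[OF ys, of m' m'] m'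
      by (simp add: s_def g_def run_dir_def run_start_def block_def comp_def)
  qed
qed

section \<open>Choice of the next disk\<close>

lemma other_tops_empty:
  assumes "xs \<noteq> []" and "\<forall>x\<in>set xs. x = hd xs"
  shows "other_tops m (sorted_config xs f) = {}"
proof -
  have "xs ! k = hd xs" if "k < length xs" for k using assms(2) that by simp
  then show ?thesis using assms(1)
    by (auto simp: other_tops_def sorted_config_def filter_empty_conv simp del: upt_Suc)
qed

text \<open>The disks smaller than \<open>Suc k\<close> share the peg of D_1 and supply no
  candidate, and none of them covers \<open>Suc k\<close>.\<close>

lemma Min_other_tops:
  assumes "set xs \<subseteq> {..<m}" and k: "k < length xs" and "xs ! k \<noteq> hd xs"
    and below: "\<forall>e<k. xs ! e = hd xs"
  shows "other_tops m (sorted_config xs f) \<noteq> {}"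
    and "Min (other_tops m (sorted_config xs f)) = Suc k"
proof -
  let ?s = "sorted_config xs f"
  have hd: "hd xs = xs ! 0" using k by (cases xs) auto
  have one: "1 \<in> set (stack ?s i) \<longleftrightarrow> i = hd xs" for i
    using k hd by (auto simp: sorted_config_def simp del: upt_Suc)
  have fin: "finite (other_tops m ?s)" by (simp add: other_tops_def)
  have "stack ?s (xs ! k) = Suc k # filter (\<lambda>d. xs ! (d - 1) = xs ! k) [Suc (Suc k)..<length xs + 1]"
    using stack_sorted_split[OF k, of "xs ! k" f] below assms(3) by simp
  then have mem: "Suc k \<in> other_tops m ?s"
    unfolding other_tops_def one using assms(1,3) k
    by (auto intro!: exI[of _ "xs ! k"] simp: subset_eq)
  have le: "Suc k \<le> d" if d: "d \<in> other_tops m ?s" for d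
  proof -
    obtain i where i: "i \<noteq> hd xs" "stack ?s i \<noteq> []" "d = hd (stack ?s i)"
      using d unfolding other_tops_def one by auto
    then have "d \<in> set (stack ?s i)" by simp
    then have "1 \<le> d" "xs ! (d - 1) = i" by (auto simp: sorted_config_def)
    then show ?thesis using below i(1) by (metis One_nat_def Suc_pred less_eq_Suc_le not_less_eq_eq)
  qed
  show "other_tops m ?s \<noteq> {}" using mem by auto
  show "Min (other_tops m ?s) = Suc k" using fin mem le by (intro Min_eqI) auto
qed

section \<open>The main loop\<close>

text \<open>The digit of \<open>D\<^sub>1\<close> is not part of \<open>ys\<close>, so position \<open>k\<close> belongs to disk \<open>k + 2\<close>.\<close>
definition keeps_dir :: "nat \<Rightarrow> nat list \<Rightarrow> (nat \<Rightarrow> direction option) \<Rightarrow> bool" where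
  "keeps_dir m ys f \<longleftrightarrow> (\<forall>k<length ys. 0 < ys ! k \<longrightarrow> ys ! k < m - 1 \<longrightarrow>
     f (Suc (Suc k)) = Some (run_dir (drop (Suc k) ys)))"

lemma step_sorted:
  fixes f :: "nat \<Rightarrow> direction option"
  assumes "odd m" and "m \<ge> 2" and ys: "set ys \<subseteq> {..<m}" and keeps: "keeps_dir m ys f"
    and succ: "gray_succ m ys = Some zs"
  defines "s \<equiv> sorted_config (run_end m ys # ys) f"
  shows "other_tops m s \<noteq> {}"
    and "\<exists>\<epsilon> g. step_dir m s (Min (other_tops m s)) = Some \<epsilon> \<and>
      move m (Min (other_tops m s)) \<epsilon> s = Some (sorted_config (run_start m zs # zs) g) \<and>
      keeps_dir m zs g"
proof -
  obtain k j where k: "k < length ys" and zs: "zs = ys[k := j]"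
    and below: "\<forall>e<k. ys ! e = run_end m ys"
    and j: "neighbour m (run_dir (drop (Suc k) ys)) (ys ! k) = Some j"
    and ne: "ys ! k \<noteq> run_end m ys" "j \<noteq> run_end m ys"
    using gray_succ_Some[OF assms(1) ys succ] by auto
  let ?xs = "run_end m ys # ys" and ?\<epsilon> = "run_dir (drop (Suc k) ys)"
  have xs: "set ?xs \<subseteq> {..<m}" using ys assms(2) run_end_less by auto
  have below': "\<forall>e<Suc k. ?xs ! e = run_end m ys"
    using below by (auto simp: nth_Cons split: nat.splits)
  have Min: "Min (other_tops m s) = Suc (Suc k)"
    and nonempty: "other_tops m s \<noteq> {}"
    using Min_other_tops[OF xs, of "Suc k" f] k ne below' by (simp_all add: s_def)
  show "other_tops m s \<noteq> {}" by (fact nonempty)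
  have peg: "peg_of m s (Suc (Suc k)) = ys ! k"
    using peg_of_sorted[OF xs, of "Suc k" f] k by (simp add: s_def)
  have "ys ! k < m" using ys k by (auto simp: subset_eq)
  \<comment> \<open>On an extreme peg the existence of \<open>j\<close> leaves only one direction;
    on an inner peg \<open>keeps_dir\<close> supplies the previous one.\<close>
  then have dir: "step_dir m s (Suc (Suc k)) = Some ?\<epsilon>"
    using j keeps k peg unfolding step_dir_def keeps_dir_def
    by (cases ?\<epsilon>) (auto simp: s_def sorted_config_def split: if_splits)
  let ?g = "f(Suc (Suc k) := Some ?\<epsilon>)"
  have "move m (Suc (Suc k)) ?\<epsilon> s = Some (sorted_config (run_end m ys # zs) ?g)"
    using move_sorted[OF xs, of "Suc k" ?\<epsilon> j f] k j ne below' zs by (simp add: s_def)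
  then have "move m (Suc (Suc k)) ?\<epsilon> s = Some (sorted_config (run_start m zs # zs) ?g)"
    using run_start_succ[OF succ] by simp
  \<comment> \<open>Digits before \<open>k\<close> see a changed parity above them but are on
    extreme pegs, where nothing is required. Those from \<open>k\<close> on keep their suffix, and
    the direction of digit \<open>k\<close> has just been stored.\<close>
  moreover have "keeps_dir m zs ?g"
    unfolding keeps_dir_def
  proof (intro allI impI)
    fix e assume e: "e < length zs" "0 < zs ! e" "zs ! e < m - 1"
    consider "e < k" | "e = k" | "e > k" by linarith
    then show "?g (Suc (Suc e)) = Some (run_dir (drop (Suc e) zs))"
    proof cases
      case 1
      then have "zs ! e = run_end m ys" using below zs by simp
      then show ?thesis using e by (auto simp: run_end_def split: if_splits)
    next
      case 2
      then show ?thesis using zs by simp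
    next
      case 3
      then show ?thesis using e keeps zs by (simp add: keeps_dir_def)
    qed
  qed
  ultimately show "\<exists>\<epsilon> g. step_dir m s (Min (other_tops m s)) = Some \<epsilon> \<and>
      move m (Min (other_tops m s)) \<epsilon> s = Some (sorted_config (run_start m zs # zs) g) \<and>
      keeps_dir m zs g"
    using dir Min by auto
qed

text \<open>Each tuple of the larger disks accounts for one pass of the loop, whose sweep yields its
  block. Induction on the finite chain of these tuples therefore also gives termination.\<close>

lemma odd_loop_sorted:
  assumes "odd m" and "m \<ge> 2"
  shows "gray_chain m (ys # yss) \<Longrightarrow> gray_succ m (last (ys # yss)) = None \<Longrightarrow>
    set ys \<subseteq> {..<m} \<Longrightarrow> keeps_dir m ys f \<Longrightarrow>
    \<exists>ss. odd_loop m (sorted_config (run_start m ys # ys) f) = Some ss \<and>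
      map (peg_tuple m (Suc (length ys))) (sorted_config (run_start m ys # ys) f # ss) =
      map rev (concat (map (block m) (ys # yss)))"
proof (induction yss arbitrary: ys f)
  have m: "m > 0" using assms(2) by simp
  have sweep: "map (peg_tuple m (Suc (length ys)))
      (sorted_config (run_start m ys # ys) f # map (\<lambda>xs. sorted_config xs g) (tl (block m ys))) =
      map rev (block m ys)"
    and sweep_last: "last (sorted_config (run_start m ys # ys) f #
      map (\<lambda>xs. sorted_config xs g) (tl (block m ys))) = sorted_config (run_end m ys # ys) g"
    if ys: "set ys \<subseteq> {..<m}" for ys f g
  proof -
    obtain bs where bs: "block m ys = (run_start m ys # ys) # bs"
      using hd_block[OF m, of ys] block_nonempty[OF m, of ys] by (cases "block m ys") auto
    have tuple: "peg_tuple m (Suc (length ys)) (sorted_config xs h) = rev xs"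
      if "xs \<in> set (block m ys)" for xs h
    proof -
      have "set xs \<subseteq> {..<m}" "length xs = Suc (length ys)"
        using that ys by (auto simp: block_def split: if_splits)
      then show ?thesis using peg_tuple_sorted by metis
    qed
    then show "map (peg_tuple m (Suc (length ys)))
      (sorted_config (run_start m ys # ys) f # map (\<lambda>xs. sorted_config xs g) (tl (block m ys))) =
      map rev (block m ys)" using bs by auto
    have "length (block m ys) = m" by (simp add: block_def)
    \<comment> \<open>A nonempty sweep makes the last configuration carry \<open>g\<close> instead
      of \<open>f\<close>.\<close>
    then have "bs \<noteq> []" using bs assms(2) by auto
    then show "last (sorted_config (run_start m ys # ys) f #
      map (\<lambda>xs. sorted_config xs g) (tl (block m ys))) = sorted_config (run_end m ys # ys) g"
      using last_block[OF m, of ys] bs by (simp add: last_map)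
  qed
  {
    case (Nil ys f)
    let ?g = "f(1 := Some (run_dir ys))"
    have "\<forall>y\<in>set ys. y = run_end m ys" using gray_succ_None[OF assms(1)] Nil by simp
    then have "other_tops m (sorted_config (run_end m ys # ys) ?g) = {}"
      by (intro other_tops_empty) auto
    then have "odd_loop m (sorted_config (run_start m ys # ys) f) =
        Some (map (\<lambda>xs. sorted_config xs ?g) (tl (block m ys)))"
      using sweep_sorted[OF assms(2) Nil(3), of f] sweep_last[OF Nil(3), of f ?g]
      by (subst odd_loop.simps) (simp del: last.simps fun_upd_apply)
    then show ?case using sweep[OF Nil(3), of f ?g] by simp
  next
    case (Cons zs yss ys f)
    let ?g = "f(1 := Some (run_dir ys))"
    let ?ss = "map (\<lambda>xs. sorted_config xs ?g) (tl (block m ys))"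
    let ?s = "sorted_config (run_end m ys # ys) ?g"
    have succ: "gray_succ m ys = Some zs" using Cons.prems by simp
    \<comment> \<open>The invariant concerns disks from 2 on, so storing the direction of D_1
      preserves it.\<close>
    have "keeps_dir m ys ?g" using Cons.prems(4) by (simp add: keeps_dir_def)
    from step_sorted[OF assms Cons.prems(3) this succ]
    obtain \<epsilon> h where nonempty: "other_tops m ?s \<noteq> {}"
      and \<epsilon>: "step_dir m ?s (Min (other_tops m ?s)) = Some \<epsilon>"
      and move: "move m (Min (other_tops m ?s)) \<epsilon> ?s = Some (sorted_config (run_start m zs # zs) h)"
      and keeps: "keeps_dir m zs h"
      by blast
    have zs: "set zs \<subseteq> {..<m}" using set_gray_succ[OF succ Cons.prems(3)] .
    obtain ts where ts: "odd_loop m (sorted_config (run_start m zs # zs) h) = Some ts"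
      "map (peg_tuple m (Suc (length zs))) (sorted_config (run_start m zs # zs) h # ts) =
      map rev (concat (map (block m) (zs # yss)))"
      using Cons.IH[OF _ _ zs keeps] Cons.prems by auto
    have "odd_loop m (sorted_config (run_start m ys # ys) f) =
        Some (?ss @ sorted_config (run_start m zs # zs) h # ts)"
      using sweep_sorted[OF assms(2) Cons.prems(3), of f] sweep_last[OF Cons.prems(3), of f ?g]
        nonempty \<epsilon> move ts(1)
      by (subst odd_loop.simps) (simp add: Let_def del: last.simps fun_upd_apply)
    moreover have "map (peg_tuple m (Suc (length ys))) ((sorted_config (run_start m ys # ys) f # ?ss) @
        sorted_config (run_start m zs # zs) h # ts) =
        map rev (concat (map (block m) (ys # zs # yss)))"
      unfolding map_append sweep[OF Cons.prems(3), of f ?g]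
      using ts(2) length_gray_succ[OF succ] by simp
    ultimately show ?case by auto
  }
qed

theorem theorem1:
  fixes m n :: nat
  assumes "m \<ge> 3" and "odd m" and "n \<ge> 1"
  shows "recorded_tuples m n = Some (gray_code m n)"
proof -
  obtain n' where n': "n = Suc n'" using assms(3) by (cases n) auto
  have m: "m > 0" "m \<ge> 2" using assms(1) by auto
  \<comment> \<open>The chain describes the \<open>n'\<close> disks other than D_1; its blocks add
    the digit of D_1.\<close>
  note chain = gray_code_chain[OF m(1), of n']
  let ?z = "replicate n' (0::nat)"
  obtain yss where yss: "map rev (gray_code m n') = ?z # yss"
    using chain by (cases "map rev (gray_code m n')") auto
  have start: "run_start m ?z = 0" by (simp add: run_start_def sum_list_replicate)
  have "set ?z \<subseteq> {..<m}" using m(1) by auto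
  \<comment> \<open>On peg 0 the invariant demands nothing, which suits the initial value
    \<open>None\<close>.\<close>
  moreover have "keeps_dir m ?z (\<lambda>_. None)" by (simp add: keeps_dir_def)
  moreover have "gray_chain m (?z # yss)" "gray_succ m (last (?z # yss)) = None"
    using chain unfolding yss by auto
  ultimately obtain ss where ss: "odd_loop m (initial n) = Some ss"
    "map (peg_tuple m n) (initial n # ss) = map rev (concat (map (block m) (?z # yss)))"
    using odd_loop_sorted[OF assms(2) m(2), of ?z yss "\<lambda>_. None"]
    unfolding start initial_sorted n' by auto
  have "map rev (gray_code m n) = concat (map (block m) (?z # yss))"
    using gray_code_Suc_blocks[of m n'] chain unfolding n' yss by blast
  then have "map (peg_tuple m n) (initial n # ss) = gray_code m n"
    unfolding ss(2) by (metis map_map map_idI comp_apply rev_rev_ident)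
  then show ?thesis
    using ss(1) by (simp add: recorded_tuples_def algorithm_ODD_def)
qed

end
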